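(* Suppose that $\langle F(X,t),X\rangle\le 0$ for all $t$ and all $X\in\mathbb{R}^{m_1\times m_2}$. Then the numerical solutions produced by the Merge method or by the Merge-adapt method (both with time step $\Delta t>0$ and truncation tolerances $\epsilon_1,\epsilon_2\ge 0$) satisfy $$\|\hat X^{n+1}\|\le \|\hat X^{n}\|.$$
   Context: Setting. Consider the matrix differential equation $\frac{d}{dt}X(t)=F(X(t),t)$, $X(0)=X_0$, $X(t)\in\mathbb{R}^{m_1\times m_2}$, where $F(X,t)=\sum_{j=1}^{s_{\rm sep}}A_jXB_j^T+G(t)$ with $A_j\in\mathbb{R}^{m_1\times m_1}$, $B_j\in\mathbb{R}^{m_2\times m_2}$ and $G(t)\in\mathbb{R}^{m_1\times m_2}$ given. Here $\langle A,B\rangle=\sum_{i,j}A_{ij}B_{ij}$ and $\|A\|=\langle A,A\rangle^{1/2}$ is the Frobenius norm. Time levels are $t^n=n\Delta t$. Truncation. For a matrix $A$ of rank $r$ with reduced SVD $A=U\,\mathrm{diag}(\sigma_1,\dots,\sigma_r)V^T$, $\sigma_1\ge\dots\ge\sigma_r>0$, the truncated SVD $\mathcal{T}^{svd}_\epsilon(A)$ keeps the leading $s$ singular triplets, where $s$ is the smallest integer with $(\sum_{j=s+1}^r\sigma_j^2)^{1/2}\le\epsilon$. $\mathcal{T}^{sum}_\epsilon(\sum_j X_j)$ denotes the truncated SVD, with tolerance $\epsilon$, of a sum of low rank matrices. Orthogonalization. For a matrix $M$, $\mathrm{orth}(M)$ denotes a matrix with orthonormal columns whose column space is that of $M$ (computed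 by column-pivoted QR). Both methods take the solution $\hat X^n=\hat U^n\hat\Sigma^n(\hat V^n)^T$ at $t^n$ (in SVD form, $\hat U^n,\hat V^n$ with orthonormal columns) and return $\hat X^{n+1}$ at $t^{n+1}=t^n+\Delta t$. The linear systems occurring in them are understood to be solved exactly. BUG spaces. $K^{n+1}$ solves $K^{n+1}-\hat U^n\hat\Sigma^n=\Delta t\,F(K^{n+1}(\hat V^n)^T,t^{n+1})\hat V^n$ and $L^{n+1}$ solves $L^{n+1}-\hat V^n\hat\Sigma^n=\Delta t\,F(\hat U^n(L^{n+1})^T,t^{n+1})^T\hat U^n$. Galerkin and truncation steps for given $\tilde U\in\mathbb{R}^{m_1\times s_1}$, $\tilde V\in\mathbb{R}^{m_2\times s_2}$ with orthonormal columns: find $\tilde\Sigma\in\mathbb{R}^{s_1\times s_2}$ with $$\tilde\Sigma=\tilde U^T\big(\hat X^n+\Delta t\,F(\tilde U\tilde\Sigma\tilde V^T,t^{n+1})\big)\tilde V,$$ and set $\hat X^{n+1}=\tilde U\,\mathcal{T}^{svd}_{\epsilon_2}(\tilde\Sigma)\,\tilde V^T$. Merge method. Compute the truncated SVD $\mathcal{U}\mathcal{S}\mathcal{V}^T=\mathcal{T}^{sum}_{\epsilon_1}(F(\hat X^n,t^n))$ and the BUG matrices $K^{n+1},L^{n+1}$; set $\tilde U=\mathrm{orth}([\hat U^n,\mathcal{U},K^{n+1}])$, $\tilde V=\mathrm{orth}([\hat V^n,\mathcal{V},L^{n+1}])$; perform the Galerkin and truncation steps with these $\tilde U,\tilde V$.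 Merge-adapt method. (Steps 1-4) Compute $\mathcal{U}\mathcal{S}\mathcal{V}^T=\mathcal{T}^{sum}_{\epsilon_1}(F(\hat X^n,t^n))$, set $\tilde U=\mathrm{orth}([\hat U^n,\mathcal{U}])$, $\tilde V=\mathrm{orth}([\hat V^n,\mathcal{V}])$, and perform the Galerkin and truncation steps to get $\hat X^{n+1}$. (Step 5) Compute $\hat R^{n+1}=\hat X^{n+1}-\hat X^n-\Delta t\,F(\hat X^{n+1},t^{n+1})$; if $\|\hat R^{n+1}\|<\epsilon_2$, return $\hat X^{n+1}$. (Steps 6-8) Otherwise discard this and return the result of one step of the Merge method started from $\hat X^n$. *)

theory Defs
  imports Complex_Main "Jordan_Normal_Form.VS_Connect"
begin

text \<open>Matrices are those of \<^theory>\<open>Jordan_Normal_Form.Matrix\<close>, because the numbers of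
  columns of the factors (the ranks) are determined by the algorithm and not fixed in advance.
  Factors with no columns (approximations of rank 0) are allowed.
  The factorizations used by the algorithms are not unique, so every algorithmic step is a
  relation between its input and each admissible output.\<close>

definition frob_inner :: "real mat \<Rightarrow> real mat \<Rightarrow> real" where
  "frob_inner A B = (\<Sum>i<dim_row A. \<Sum>j<dim_col A. A $$ (i, j) * B $$ (i, j))"

definition frob_norm :: "real mat \<Rightarrow> real" where
  "frob_norm A = sqrt (frob_inner A A)"

text \<open>The sum over \<open>j\<close> is written entrywise, since matrix types carry no fixed dimension and
  hence no neutral element for the generic summation operator.\<close>

definition sep_rhs ::
  "nat \<Rightarrow> nat \<Rightarrow> nat \<Rightarrow> (nat \<Rightarrow> real mat) \<Rightarrow> (nat \<Rightarrow> real mat) \<Rightarrow> (real \<Rightarrow> real mat)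
    \<Rightarrow> real mat \<Rightarrow> real \<Rightarrow> real mat" where
  "sep_rhs m1 m2 s A B G X t =
     mat m1 m2 (\<lambda>(i, k). \<Sum>j = 1..s. (A j * X * (B j)\<^sup>T) $$ (i, k)) + G t"

definition orthonormal_cols :: "real mat \<Rightarrow> bool" where
  "orthonormal_cols U \<longleftrightarrow> U\<^sup>T * U = 1\<^sub>m (dim_col U)"

definition hcat :: "nat \<Rightarrow> real mat list \<Rightarrow> real mat" where
  "hcat m Ms = mat_of_cols m (concat (map cols Ms))"

definition first_cols :: "nat \<Rightarrow> real mat \<Rightarrow> real mat" where
  "first_cols s U = mat_of_cols (dim_row U) (take s (cols U))"

definition is_orth :: "real mat \<Rightarrow> real mat \<Rightarrow> bool" where
  "is_orth M Q \<longleftrightarrow> dim_row Q = dim_row M \<and> orthonormal_cols Q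
     \<and> vec_space.col_space (dim_row M) Q = vec_space.col_space (dim_row M) M"

definition diag_of :: "real list \<Rightarrow> real mat" where
  "diag_of \<sigma> = mat_diag (length \<sigma>) (\<lambda>i. \<sigma> ! i)"

text \<open>Positivity of the singular values forces \<open>length \<sigma>\<close> to be the rank of \<open>A\<close>.\<close>

definition reduced_svd :: "real mat \<Rightarrow> real mat \<Rightarrow> real list \<Rightarrow> real mat \<Rightarrow> bool" where
  "reduced_svd A U \<sigma> V \<longleftrightarrow>
     U \<in> carrier_mat (dim_row A) (length \<sigma>) \<and> orthonormal_cols U \<and>
     V \<in> carrier_mat (dim_col A) (length \<sigma>) \<and> orthonormal_cols V \<and>
     sorted_wrt (\<ge>) \<sigma> \<and> (\<forall>x\<in>set \<sigma>. 0 < x) \<and>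
     A = U * diag_of \<sigma> * V\<^sup>T"

definition trunc_rank :: "real \<Rightarrow> real list \<Rightarrow> nat" where
  "trunc_rank \<epsilon> \<sigma> = (LEAST s. sqrt (\<Sum>x\<leftarrow>drop s \<sigma>. x\<^sup>2) \<le> \<epsilon>)"

definition truncated_svd :: "real \<Rightarrow> real mat \<Rightarrow> real mat \<Rightarrow> real list \<Rightarrow> real mat \<Rightarrow> bool" where
  "truncated_svd \<epsilon> A U \<sigma> V \<longleftrightarrow>
     (\<exists>U0 \<sigma>0 V0. reduced_svd A U0 \<sigma>0 V0 \<and>
        (let s = trunc_rank \<epsilon> \<sigma>0
         in U = first_cols s U0 \<and> \<sigma> = take s \<sigma>0 \<and> V = first_cols s V0))"

text \<open>In the following, \<open>t1\<close> is the new time level, \<open>X\<close> is the current approximation, and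
  \<open>U\<close>, \<open>diag_of \<sigma>\<close>, \<open>V\<close> are the factors of its SVD.\<close>

definition bug_K ::
  "(real mat \<Rightarrow> real \<Rightarrow> real mat) \<Rightarrow> real \<Rightarrow> real
    \<Rightarrow> real mat \<Rightarrow> real list \<Rightarrow> real mat \<Rightarrow> real mat \<Rightarrow> bool" where
  "bug_K F \<Delta>t t1 U \<sigma> V K \<longleftrightarrow>
     K \<in> carrier_mat (dim_row U) (length \<sigma>) \<and>
     K - U * diag_of \<sigma> = \<Delta>t \<cdot>\<^sub>m (F (K * V\<^sup>T) t1 * V)"

definition bug_L ::
  "(real mat \<Rightarrow> real \<Rightarrow> real mat) \<Rightarrow> real \<Rightarrow> real
    \<Rightarrow> real mat \<Rightarrow> real list \<Rightarrow> real mat \<Rightarrow> real mat \<Rightarrow> bool" where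
  "bug_L F \<Delta>t t1 U \<sigma> V L \<longleftrightarrow>
     L \<in> carrier_mat (dim_row V) (length \<sigma>) \<and>
     L - V * diag_of \<sigma> = \<Delta>t \<cdot>\<^sub>m ((F (U * L\<^sup>T) t1)\<^sup>T * U)"

definition galerkin_truncate ::
  "(real mat \<Rightarrow> real \<Rightarrow> real mat) \<Rightarrow> real \<Rightarrow> real \<Rightarrow> real
    \<Rightarrow> real mat \<Rightarrow> real mat \<Rightarrow> real mat \<Rightarrow> real mat \<Rightarrow> bool" where
  "galerkin_truncate F \<Delta>t \<epsilon>2 t1 X Ut Vt X' \<longleftrightarrow>
     (\<exists>\<Sigma> \<in> carrier_mat (dim_col Ut) (dim_col Vt).
        \<Sigma> = Ut\<^sup>T * (X + \<Delta>t \<cdot>\<^sub>m F (Ut * \<Sigma> * Vt\<^sup>T) t1) * Vt \<and>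
        (\<exists>P \<tau> Q. truncated_svd \<epsilon>2 \<Sigma> P \<tau> Q \<and> X' = Ut * (P * diag_of \<tau> * Q\<^sup>T) * Vt\<^sup>T))"

definition merge_step ::
  "(real mat \<Rightarrow> real \<Rightarrow> real mat) \<Rightarrow> real \<Rightarrow> real \<Rightarrow> real \<Rightarrow> nat
    \<Rightarrow> real mat \<Rightarrow> real mat \<Rightarrow> real list \<Rightarrow> real mat \<Rightarrow> real mat \<Rightarrow> bool" where
  "merge_step F \<Delta>t \<epsilon>1 \<epsilon>2 n X U \<sigma> V X' \<longleftrightarrow>
     (let t0 = real n * \<Delta>t; t1 = real (Suc n) * \<Delta>t in
      \<exists>W \<rho> Z K L Ut Vt.
        truncated_svd \<epsilon>1 (F X t0) W \<rho> Z \<and>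
        bug_K F \<Delta>t t1 U \<sigma> V K \<and>
        bug_L F \<Delta>t t1 U \<sigma> V L \<and>
        is_orth (hcat (dim_row U) [U, W, K]) Ut \<and>
        is_orth (hcat (dim_row V) [V, Z, L]) Vt \<and>
        galerkin_truncate F \<Delta>t \<epsilon>2 t1 X Ut Vt X')"

definition merge_adapt_step ::
  "(real mat \<Rightarrow> real \<Rightarrow> real mat) \<Rightarrow> real \<Rightarrow> real \<Rightarrow> real \<Rightarrow> nat
    \<Rightarrow> real mat \<Rightarrow> real mat \<Rightarrow> real list \<Rightarrow> real mat \<Rightarrow> real mat \<Rightarrow> bool" where
  "merge_adapt_step F \<Delta>t \<epsilon>1 \<epsilon>2 n X U \<sigma> V X' \<longleftrightarrow>
     (let t0 = real n * \<Delta>t; t1 = real (Suc n) * \<Delta>t in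
      \<exists>W \<rho> Z Ut Vt Y.
        truncated_svd \<epsilon>1 (F X t0) W \<rho> Z \<and>
        is_orth (hcat (dim_row U) [U, W]) Ut \<and>
        is_orth (hcat (dim_row V) [V, Z]) Vt \<and>
        galerkin_truncate F \<Delta>t \<epsilon>2 t1 X Ut Vt Y \<and>
        (if frob_norm (Y - X - \<Delta>t \<cdot>\<^sub>m F Y t1) < \<epsilon>2 then X' = Y
         else merge_step F \<Delta>t \<epsilon>1 \<epsilon>2 n X U \<sigma> V X'))"

end

theory Submission
  imports Defs
begin

text \<open>Write \<open>Y\<close> for the Galerkin solution \<open>Ut * \<Sigma> * Vt\<^sup>T\<close>. Testing the Galerkin equation with
  \<open>\<Sigma>\<close> and moving \<open>Ut\<close>, \<open>Vt\<close> to the other side of the inner product gives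
  \<open>\<parallel>\<Sigma>\<parallel>\<^sup>2 = \<langle>X, Y\<rangle> + \<Delta>t \<langle>F(Y), Y\<rangle> \<le> \<langle>X, Y\<rangle> \<le> (\<parallel>X\<parallel>\<^sup>2 + \<parallel>Y\<parallel>\<^sup>2) / 2\<close>. Since \<open>\<parallel>Y\<parallel> = \<parallel>\<Sigma>\<parallel>\<close>, this is
  \<open>\<parallel>\<Sigma>\<parallel> \<le> \<parallel>X\<parallel>\<close>, and dropping singular values only decreases the norm. The choice of the spaces
  spanned by \<open>Ut\<close> and \<open>Vt\<close> plays no role.\<close>

section \<open>The Frobenius inner product: adjoints and isometries\<close>

lemma frob_inner_add_left:
  assumes "M \<in> carrier_mat p q" "N \<in> carrier_mat p q" "R \<in> carrier_mat p q"
  shows "frob_inner (M + N) R = frob_inner M R + frob_inner N R"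
  using assms by (simp add: frob_inner_def distrib_right sum.distrib)

lemma frob_inner_smult_left:
  assumes "M \<in> carrier_mat p q" "N \<in> carrier_mat p q"
  shows "frob_inner (c \<cdot>\<^sub>m M) N = c * frob_inner M N"
  using assms by (simp add: frob_inner_def sum_distrib_left mult.assoc)

lemma frob_inner_transpose:
  assumes "M \<in> carrier_mat p q" "N \<in> carrier_mat p q"
  shows "frob_inner M\<^sup>T N\<^sup>T = frob_inner M N"
proof -
  have "frob_inner M\<^sup>T N\<^sup>T = (\<Sum>j<q. \<Sum>i<p. M $$ (i, j) * N $$ (i, j))"
    using assms by (simp add: frob_inner_def)
  also have "\<dots> = (\<Sum>i<p. \<Sum>j<q. M $$ (i, j) * N $$ (i, j))"
    by (rule sum.swap)
  finally show ?thesis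
    using assms by (simp add: frob_inner_def)
qed

text \<open>Entrywise, this is \<open>(a - b)\<^sup>2 \<ge> 0\<close> summed up. It takes the place
  of Cauchy-Schwarz and keeps the argument free of square roots.\<close>

lemma frob_inner_le_mean:
  assumes "M \<in> carrier_mat p q" "N \<in> carrier_mat p q"
  shows "2 * frob_inner M N \<le> frob_inner M M + frob_inner N N"
proof -
  have *: "2 * (a * b) \<le> a * a + b * b" for a b :: real
    using zero_le_square[of "a - b"] by (simp add: algebra_simps)
  have "2 * frob_inner M N = (\<Sum>i<p. \<Sum>j<q. 2 * (M $$ (i, j) * N $$ (i, j)))"
    using assms by (simp add: frob_inner_def sum_distrib_left)
  also have "\<dots> \<le> (\<Sum>i<p. \<Sum>j<q. M $$ (i, j) * M $$ (i, j) + N $$ (i, j) * N $$ (i, j))"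
    by (intro sum_mono *)
  also have "\<dots> = frob_inner M M + frob_inner N N"
    using assms by (simp add: frob_inner_def sum.distrib)
  finally show ?thesis .
qed

text \<open>Both sides are the triple sum of \<open>L $$ (i, k) * M $$ (k, j) * N $$ (i, j)\<close>;
  three exchanges of neighbouring sums bring the summation over \<open>i\<close> inside, where it
  forms the entries of \<open>L\<^sup>T * N\<close>.\<close>

lemma frob_inner_mult_left:
  assumes L: "L \<in> carrier_mat p q" and M: "M \<in> carrier_mat q r" and N: "N \<in> carrier_mat p r"
  shows "frob_inner (L * M) N = frob_inner M (L\<^sup>T * N)"
proof -
  have "frob_inner (L * M) N = (\<Sum>i<p. \<Sum>j<r. \<Sum>k<q. L $$ (i, k) * M $$ (k, j) * N $$ (i, j))"
    using assms by (simp add: frob_inner_def scalar_prod_def sum_distrib_right lessThan_atLeast0)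
  also have "\<dots> = (\<Sum>i<p. \<Sum>k<q. \<Sum>j<r. L $$ (i, k) * M $$ (k, j) * N $$ (i, j))"
    by (rule sum.cong[OF refl], rule sum.swap)
  also have "\<dots> = (\<Sum>k<q. \<Sum>i<p. \<Sum>j<r. L $$ (i, k) * M $$ (k, j) * N $$ (i, j))"
    by (rule sum.swap)
  also have "\<dots> = (\<Sum>k<q. \<Sum>j<r. \<Sum>i<p. L $$ (i, k) * M $$ (k, j) * N $$ (i, j))"
    by (rule sum.cong[OF refl], rule sum.swap)
  also have "\<dots> = frob_inner M (L\<^sup>T * N)"
    using assms
    by (simp add: frob_inner_def scalar_prod_def sum_distrib_left lessThan_atLeast0 mult_ac)
  finally show ?thesis .
qed

text \<open>Transposition preserves the inner product and turns right factors into left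
  ones.\<close>

lemma frob_inner_mult_right:
  assumes L: "L \<in> carrier_mat q r" and M: "M \<in> carrier_mat p q" and N: "N \<in> carrier_mat p r"
  shows "frob_inner (M * L) N = frob_inner M (N * L\<^sup>T)"
proof -
  have "frob_inner (M * L) N = frob_inner (L\<^sup>T * M\<^sup>T) N\<^sup>T"
    using assms frob_inner_transpose[of "M * L" p r N] by (simp add: transpose_mult)
  also have "\<dots> = frob_inner M\<^sup>T (L * N\<^sup>T)"
    using assms by (subst frob_inner_mult_left[of _ r q _ p]) auto
  also have "\<dots> = frob_inner M (N * L\<^sup>T)"
    using assms frob_inner_transpose[of M p q "N * L\<^sup>T"] by (simp add: transpose_mult)
  finally show ?thesis .
qed

text \<open>Projection onto the core and lifting from it are adjoint maps. This carries the Galerkin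
  equation, tested with its core solution, back to full-size matrices, where the sign condition on
  the right-hand side applies.\<close>

lemma frob_inner_sandwich:
  assumes U: "U \<in> carrier_mat p a" and V: "V \<in> carrier_mat q b"
    and S: "S \<in> carrier_mat a b" and M: "M \<in> carrier_mat p q"
  shows "frob_inner (U\<^sup>T * M * V) S = frob_inner M (U * S * V\<^sup>T)"
proof -
  have "frob_inner (U\<^sup>T * M * V) S = frob_inner (U\<^sup>T * M) (S * V\<^sup>T)"
    using assms by (subst frob_inner_mult_right[of _ q b _ a]) auto
  also have "\<dots> = frob_inner M (U * (S * V\<^sup>T))"
    using assms by (subst frob_inner_mult_left[of _ a p _ q]) auto
  also have "U * (S * V\<^sup>T) = U * S * V\<^sup>T"
    using assms by (simp add: assoc_mult_mat[of _ p a _ b _ q])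
  finally show ?thesis .
qed

text \<open>The lifting is an isometry because its adjoint is a left inverse:
  \<open>U\<^sup>T * U\<close> and \<open>V\<^sup>T * V\<close> cancel.\<close>

lemma frob_inner_orthonormal:
  assumes U: "U \<in> carrier_mat p a" "orthonormal_cols U"
    and V: "V \<in> carrier_mat q b" "orthonormal_cols V" and S: "S \<in> carrier_mat a b"
  shows "frob_inner (U * S * V\<^sup>T) (U * S * V\<^sup>T) = frob_inner S S"
proof -
  have UU: "U\<^sup>T * U = 1\<^sub>m a" and VV: "V\<^sup>T * V = 1\<^sub>m b"
    using U V by (auto simp: orthonormal_cols_def)
  have US: "U * S \<in> carrier_mat p b" using U S by auto
  have "U\<^sup>T * (U * S * V\<^sup>T) * V = U\<^sup>T * ((U * S * V\<^sup>T) * V)"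
    using U V S by (intro assoc_mult_mat[of _ a p _ q]) auto
  also have "(U * S * V\<^sup>T) * V = U * S"
    using US V VV right_mult_one_mat[OF US] by (simp add: assoc_mult_mat[of _ p b _ q _ b])
  also have "U\<^sup>T * (U * S) = S"
    using U S UU by (simp add: assoc_mult_mat[of _ a p _ a _ b, symmetric])
  finally have "U\<^sup>T * (U * S * V\<^sup>T) * V = S" .
  then show ?thesis
    using frob_inner_sandwich[of U p a V q b S "U * S * V\<^sup>T"] U V S by auto
qed

section \<open>Norms of singular value decompositions and their truncations\<close>

lemma diag_of_carrier [simp]: "diag_of \<sigma> \<in> carrier_mat (length \<sigma>) (length \<sigma>)"
  by (simp add: diag_of_def)

lemma frob_inner_diag_of: "frob_inner (diag_of \<sigma>) (diag_of \<sigma>) = (\<Sum>x\<leftarrow>\<sigma>. x\<^sup>2)"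
proof -
  have "frob_inner (diag_of \<sigma>) (diag_of \<sigma>)
      = (\<Sum>i<length \<sigma>. \<Sum>j<length \<sigma>. if i = j then (\<sigma> ! i)\<^sup>2 else 0)"
    unfolding frob_inner_def diag_of_def
    by (intro sum.cong) (auto simp: mat_diag_def power2_eq_square)
  also have "\<dots> = (\<Sum>i<length \<sigma>. (\<sigma> ! i)\<^sup>2)"
    by simp
  finally show ?thesis
    by (simp add: sum_list_sum_nth lessThan_atLeast0)
qed

text \<open>The \<open>min\<close> arises because \<open>take\<close> returns all columns when
  \<open>s\<close> exceeds their number.\<close>

lemma first_cols_carrier:
  "U \<in> carrier_mat p a \<Longrightarrow> first_cols s U \<in> carrier_mat p (min s a)"
  by (intro carrier_matI) (simp_all add: first_cols_def min.commute)

text \<open>The Gram matrix of the leading columns is a leading principal block of that of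
  \<open>U\<close>.\<close>

lemma orthonormal_cols_first_cols:
  assumes "orthonormal_cols U"
  shows "orthonormal_cols (first_cols s U)"
proof -
  let ?W = "first_cols s U"
  have W: "?W \<in> carrier_mat (dim_row U) (min s (dim_col U))"
    by (rule first_cols_carrier) simp
  have col: "col ?W i = col U i" if "i < min s (dim_col U)" for i
  proof -
    have "col ?W i = take s (cols U) ! i"
      unfolding first_cols_def
      using that cols_dim[of U] by (intro col_mat_of_cols) auto
    then show ?thesis using that by simp
  qed
  have "col U i \<bullet> col U j = (if i = j then 1 else 0)" if "i < dim_col U" "j < dim_col U" for i j
    using arg_cong[OF assms[unfolded orthonormal_cols_def], of "\<lambda>M. M $$ (i, j)"] that by simp
  then show ?thesis
    unfolding orthonormal_cols_def using W by (intro eq_matI) (auto simp: col)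
qed

text \<open>By isometry, both squared norms are sums of squared singular values, and truncation
  omits a nonnegative tail.\<close>

lemma truncated_svdD:
  assumes "truncated_svd \<epsilon> M P \<tau> Q"
  shows "P \<in> carrier_mat (dim_row M) (length \<tau>)" "Q \<in> carrier_mat (dim_col M) (length \<tau>)"
    and "frob_inner (P * diag_of \<tau> * Q\<^sup>T) (P * diag_of \<tau> * Q\<^sup>T) \<le> frob_inner M M"
proof -
  from assms obtain U \<sigma> V k where svd: "reduced_svd M U \<sigma> V"
    and P: "P = first_cols k U" and \<tau>: "\<tau> = take k \<sigma>" and Q: "Q = first_cols k V"
    unfolding truncated_svd_def Let_def by blast
  have U: "U \<in> carrier_mat (dim_row M) (length \<sigma>)" "orthonormal_cols U"
    and V: "V \<in> carrier_mat (dim_col M) (length \<sigma>)" "orthonormal_cols V"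
    and M: "M = U * diag_of \<sigma> * V\<^sup>T"
    using svd unfolding reduced_svd_def by blast+
  show P': "P \<in> carrier_mat (dim_row M) (length \<tau>)"
    using first_cols_carrier[OF U(1), of k] by (simp add: P \<tau> min.commute)
  show Q': "Q \<in> carrier_mat (dim_col M) (length \<tau>)"
    using first_cols_carrier[OF V(1), of k] by (simp add: Q \<tau> min.commute)
  have "frob_inner (P * diag_of \<tau> * Q\<^sup>T) (P * diag_of \<tau> * Q\<^sup>T) = (\<Sum>x\<leftarrow>take k \<sigma>. x\<^sup>2)"
    using frob_inner_orthonormal[OF P' _ Q' _ diag_of_carrier]
      U(2) V(2) by (simp add: P Q \<tau> orthonormal_cols_first_cols frob_inner_diag_of)
  also have "\<dots> \<le> (\<Sum>x\<leftarrow>take k \<sigma>. x\<^sup>2) + (\<Sum>x\<leftarrow>drop k \<sigma>. x\<^sup>2)"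
    by (simp, rule sum_list_nonneg) auto
  also have "\<dots> = (\<Sum>x\<leftarrow>\<sigma>. x\<^sup>2)"
    by (metis append_take_drop_id map_append sum_list_append)
  also have "\<dots> = frob_inner M M"
    using frob_inner_orthonormal[OF U V diag_of_carrier] by (simp flip: M add: frob_inner_diag_of)
  finally show "frob_inner (P * diag_of \<tau> * Q\<^sup>T) (P * diag_of \<tau> * Q\<^sup>T) \<le> frob_inner M M" .
qed

section \<open>Norm decay in the Galerkin and truncation steps and in both methods\<close>

lemma galerkin_truncate_norm_le:
  assumes F: "\<And>Y. Y \<in> carrier_mat m1 m2 \<Longrightarrow> F Y t1 \<in> carrier_mat m1 m2"
    and dissipative: "\<And>Y. Y \<in> carrier_mat m1 m2 \<Longrightarrow> frob_inner (F Y t1) Y \<le> 0"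
    and step_size: "0 \<le> \<Delta>t"
    and X: "X \<in> carrier_mat m1 m2"
    and Ut: "dim_row Ut = m1" "orthonormal_cols Ut"
    and Vt: "dim_row Vt = m2" "orthonormal_cols Vt"
    and step: "galerkin_truncate F \<Delta>t \<epsilon> t1 X Ut Vt X'"
  shows "frob_norm X' \<le> frob_norm X"
proof -
  define a b where "a = dim_col Ut" and "b = dim_col Vt"
  have U: "Ut \<in> carrier_mat m1 a" and V: "Vt \<in> carrier_mat m2 b"
    using Ut Vt by (auto simp: a_def b_def)
  from step obtain S P \<tau> Q where S: "S \<in> carrier_mat a b"
    and galerkin: "S = Ut\<^sup>T * (X + \<Delta>t \<cdot>\<^sub>m F (Ut * S * Vt\<^sup>T) t1) * Vt"
    and trunc: "truncated_svd \<epsilon> S P \<tau> Q"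
    and X': "X' = Ut * (P * diag_of \<tau> * Q\<^sup>T) * Vt\<^sup>T"
    unfolding galerkin_truncate_def a_def b_def by blast
  define Y where "Y = Ut * S * Vt\<^sup>T"
  have Y: "Y \<in> carrier_mat m1 m2"
    using U V S by (auto simp: Y_def)
  note FY = F[OF Y]
  have "frob_inner S S = frob_inner (Ut\<^sup>T * (X + \<Delta>t \<cdot>\<^sub>m F Y t1) * Vt) S"
    using galerkin by (simp add: Y_def)
  also have "\<dots> = frob_inner (X + \<Delta>t \<cdot>\<^sub>m F Y t1) Y"
    unfolding Y_def using U V S X FY by (intro frob_inner_sandwich) (auto simp: Y_def)
  also have "\<dots> = frob_inner X Y + \<Delta>t * frob_inner (F Y t1) Y"
    using X FY Y by (simp add: frob_inner_add_left[of _ m1 m2] frob_inner_smult_left[of _ m1 m2])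
  also have "\<dots> \<le> frob_inner X Y"
    using mult_nonneg_nonpos[OF step_size dissipative[OF Y]] by simp
  finally have "frob_inner S S \<le> frob_inner X Y" .
  moreover have "frob_inner Y Y = frob_inner S S"
    unfolding Y_def by (rule frob_inner_orthonormal[OF U Ut(2) V Vt(2) S])
  \<comment> \<open>Doubling the bound gives at most \<open>frob_inner X X + frob_inner Y Y\<close>;
    the last term equals \<open>frob_inner S S\<close> and cancels one of the two copies on the
    left.\<close>
  ultimately have SX: "frob_inner S S \<le> frob_inner X X"
    using frob_inner_le_mean[OF X Y] by simp
  have "P * diag_of \<tau> * Q\<^sup>T \<in> carrier_mat a b"
    using truncated_svdD(1,2)[OF trunc] S by (auto intro!: mult_carrier_mat)
  then have "frob_inner X' X' = frob_inner (P * diag_of \<tau> * Q\<^sup>T) (P * diag_of \<tau> * Q\<^sup>T)"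
    unfolding X' by (rule frob_inner_orthonormal[OF U Ut(2) V Vt(2)])
  also have "\<dots> \<le> frob_inner X X"
    using truncated_svdD(3)[OF trunc] SX by simp
  finally show ?thesis
    by (simp add: frob_norm_def)
qed

theorem theorem3p1:
  fixes m1 m2 s n :: nat
    and A B :: "nat \<Rightarrow> real mat"
    and G :: "real \<Rightarrow> real mat"
    and F :: "real mat \<Rightarrow> real \<Rightarrow> real mat"
    and \<Delta>t \<epsilon>1 \<epsilon>2 :: real
    and X U V X' :: "real mat"
    and \<sigma> :: "real list"
  assumes A: "\<And>j. j \<in> {1..s} \<Longrightarrow> A j \<in> carrier_mat m1 m1"
    and B: "\<And>j. j \<in> {1..s} \<Longrightarrow> B j \<in> carrier_mat m2 m2"
    and G: "\<And>t. 0 \<le> t \<Longrightarrow> G t \<in> carrier_mat m1 m2"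
    and F: "F = sep_rhs m1 m2 s A B G"
    and dissipative:
      "\<And>t Y. 0 \<le> t \<Longrightarrow> Y \<in> carrier_mat m1 m2 \<Longrightarrow> frob_inner (F Y t) Y \<le> 0"
    and step_size: "0 < \<Delta>t"
    and tolerances: "0 \<le> \<epsilon>1" "0 \<le> \<epsilon>2"
    and X: "X \<in> carrier_mat m1 m2"
    and svd: "reduced_svd X U \<sigma> V"
    and step: "merge_step F \<Delta>t \<epsilon>1 \<epsilon>2 n X U \<sigma> V X'
             \<or> merge_adapt_step F \<Delta>t \<epsilon>1 \<epsilon>2 n X U \<sigma> V X'"
  shows "frob_norm X' \<le> frob_norm X"
proof -
  define t1 where "t1 = real (Suc n) * \<Delta>t"
  \<comment> \<open>The sign condition and the shape of \<open>G\<close> are assumed at nonnegative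
    times.\<close>
  have t1: "0 \<le> t1"
    using step_size by (simp add: t1_def)
  \<comment> \<open>The dimensions are read off from \<open>mat m1 m2\<close> and
    \<open>G t1\<close>.\<close>
  have FC: "F Y t1 \<in> carrier_mat m1 m2" for Y
    using G[OF t1] by (simp add: F sep_rhs_def)
  have dims: "dim_row U = m1" "dim_row V = m2"
    using svd X unfolding reduced_svd_def by auto
  \<comment> \<open>Arbitrary block lists \<open>Ms\<close> and \<open>Ns\<close> let one estimate
    serve the three-block bases of Merge and the two-block bases of Merge-adapt.\<close>
  have gal: "frob_norm Z \<le> frob_norm X"
    if "is_orth (hcat (dim_row U) Ms) Ut" "is_orth (hcat (dim_row V) Ns) Vt"
      "galerkin_truncate F \<Delta>t \<epsilon>2 t1 X Ut Vt Z" for Ms Ns Ut Vt Z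
  proof (rule galerkin_truncate_norm_le)
    show "dim_row Ut = m1" "orthonormal_cols Ut" "dim_row Vt = m2" "orthonormal_cols Vt"
      using that(1,2) dims by (auto simp: is_orth_def hcat_def)
  qed (use FC dissipative[OF t1] step_size X that(3) in auto)
  have merge: "frob_norm X' \<le> frob_norm X" if "merge_step F \<Delta>t \<epsilon>1 \<epsilon>2 n X U \<sigma> V X'"
    using that gal unfolding merge_step_def Let_def t1_def by blast
  show ?thesis
    using step
  proof
    \<comment> \<open>If the residual test succeeds, \<open>X'\<close> is the Galerkin result on the
      smaller bases and \<open>gal\<close> applies; otherwise it comes from a Merge step restarted
      at the same \<open>X\<close>.\<close>
    assume "merge_adapt_step F \<Delta>t \<epsilon>1 \<epsilon>2 n X U \<sigma> V X'"
    then show ?thesis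
      using gal merge unfolding merge_adapt_step_def Let_def t1_def
      by (metis (no_types, lifting))
  qed (rule merge)
qed

end
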